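(* There is a constant $c$, depending only on the fixed universal programming language used to define Kolmogorov complexity, such that the following holds. Let $n\ge 1$ and $C\ge 2$ be integers, let $X=(x_1,\dots,x_n)$ be inputs, let $\delta\in(0,1)$, and let the labels $Y=(y_1,\dots,y_n)$ be drawn uniformly at random from $\{1,\dots,C\}^n$. Then, with probability at least $1-\delta$ over the draw of $Y$, for every classifier $p(y|x)$ over the $C$ classes simultaneously, $$\mathrm{CE}(p)\ \ge\ \ln C-\frac{\ln 2}{n}\Big(K(p)+2\log_2 K(p)+\log_2(1/\delta)+c\Big),$$ where $\mathrm{CE}(p)=-\frac1n\sum_{i=1}^n\ln p(y_i|x_i)$ is the empirical cross entropy of $p$ on the dataset $(X,Y)$ and $K(p)$ is the Kolmogorov complexity of $p$. Consequently, for every $C\ge 2$, every $B\ge 1$, every $\varepsilon>0$ and every $\delta\in(0,1)$ there is $N$ such that for all $n\ge N$ and all inputs $X=(x_1,\dots,x_n)$, with probability at least $1-\delta$ over $Y$ uniform on $\{1,\dots,C\}^n$, every classifier $p$ over the $C$ classes with $K(p)\le B$ satisfies $\mathrm{CE}(p)\ge \ln C-\varepsilon$.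
   Context: Fix once and for all a universal programming language $L$ (equivalently, a universal Turing machine); programs are nonempty finite bitstrings. The (plain) Kolmogorov complexity $K(z)$ of a finite object $z$ is the length in bits of the shortest program in $L$ that outputs $z$; the conditional complexity $K(y|x)$ is the length of the shortest program that outputs $y$ when given $x$ as input. Inputs $x_i$ are finite objects (encoded as finite bitstrings); $X$ is fixed and arbitrary, and only the labels are random. A classifier over $C$ classes is a function $p$ assigning to each input $x$ a probability distribution $p(\cdot|x)$ on $\{1,\dots,C\}$. Its Kolmogorov complexity $K(p)$ is the length in bits of the shortest program in $L$ that computes $p$, i.e. that on input $(x,k)$, with $k\in\mathbb{N}$, outputs a vector of $C$ rationals which is within $2^{-k}$, coordinatewise, of $(p(1|x),\dots,p(C|x))$. If no such program exists, $K(p)=\infty$ and the inequality is vacuous. Programs being nonempty, $K(p)\ge 1$ and $\log_2K(p)\ge 0$. If $p(y_i|x_i)=0$ for some $i$, then $\mathrm{CE}(p)=+\infty$. $\ln$ denotes the natural logarithm. *)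

theory Defs
  imports "HOL-Probability.Probability" "HOL-Library.Nat_Bijection"
begin

section \<open>Partial recursive functions\<close>

datatype recf =
    Zero
  | Succ
  | Proj nat
  | Comp recf "recf list"
  | Prec recf recf
  | Mu recf

text \<open>
  \<open>rec_eval f xs y\<close>: the partial recursive function denoted by \<open>f\<close> is defined at \<open>xs\<close>, with
  value \<open>y\<close>. Recursion in \<^term>\<open>Prec\<close> and the search in \<^term>\<open>Mu\<close> run on the first argument.
  Arities are not tracked: a term applied to too few arguments is undefined.
\<close>

inductive rec_eval :: "recf \<Rightarrow> nat list \<Rightarrow> nat \<Rightarrow> bool" where
  "rec_eval Zero xs 0"
| "rec_eval Succ (x # xs) (Suc x)"
| "i < length xs \<Longrightarrow> rec_eval (Proj i) xs (xs ! i)"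
| "list_all2 (\<lambda>g y. rec_eval g xs y) gs ys \<Longrightarrow> rec_eval f ys z \<Longrightarrow> rec_eval (Comp f gs) xs z"
| "rec_eval f xs z \<Longrightarrow> rec_eval (Prec f g) (0 # xs) z"
| "rec_eval (Prec f g) (m # xs) r \<Longrightarrow> rec_eval g (m # r # xs) z
    \<Longrightarrow> rec_eval (Prec f g) (Suc m # xs) z"
| "rec_eval f (m # xs) 0 \<Longrightarrow> (\<forall>i<m. \<exists>v. rec_eval f (i # xs) (Suc v)) \<Longrightarrow> rec_eval (Mu f) xs m"


section \<open>Bitstrings and encodings of finite objects\<close>

type_synonym bits = "bool list"

text \<open>Bijective base-2 numeration, least significant digit first; \<open>False\<close> is the digit 1 and
  \<open>True\<close> the digit 2.\<close>

fun nat_of_bits :: "bits \<Rightarrow> nat" where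
  "nat_of_bits [] = 0"
| "nat_of_bits (b # bs) = 2 * nat_of_bits bs + (if b then 2 else 1)"

fun bits_of_nat :: "nat \<Rightarrow> bits" where
  "bits_of_nat n = (if n = 0 then [] else even n # bits_of_nat ((n - 1) div 2))"

declare bits_of_nat.simps [simp del]

lemma bits_of_nat_inverse [simp]: "nat_of_bits (bits_of_nat n) = n"
proof (induction n rule: less_induct)
  case (less n)
  show ?case
  proof (cases "n = 0")
    case True
    then show ?thesis by (simp add: bits_of_nat.simps)
  next
    case False
    then have "nat_of_bits (bits_of_nat ((n - 1) div 2)) = (n - 1) div 2"
      by (intro less) linarith
    with False show ?thesis
      by (subst bits_of_nat.simps) (auto elim!: evenE oddE)
  qed
qed

lemma nat_of_bits_inverse [simp]: "bits_of_nat (nat_of_bits bs) = bs"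
proof (induction bs)
  case Nil
  show ?case by (simp add: bits_of_nat.simps)
next
  case (Cons b bs)
  have "(nat_of_bits (b # bs) - 1) div 2 = nat_of_bits bs"
    by (cases b) auto
  then show ?case
    by (subst bits_of_nat.simps) (use Cons in auto)
qed

definition encode_query :: "bits \<Rightarrow> nat \<Rightarrow> bits" where
  "encode_query x k = bits_of_nat (prod_encode (nat_of_bits x, k))"

definition rat_encode :: "rat \<Rightarrow> nat" where
  "rat_encode r = (case quotient_of r of (a, b) \<Rightarrow> prod_encode (int_encode a, nat b))"

definition encode_rats :: "rat list \<Rightarrow> bits" where
  "encode_rats rs = bits_of_nat (list_encode (map rat_encode rs))"


section \<open>Universal programming languages\<close>

text \<open>A programming language maps a program and an input to an output, if the program halts on
  that input.\<close>

type_synonym language = "bits \<Rightarrow> bits \<Rightarrow> bits option"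

definition computable_language :: "language \<Rightarrow> bool" where
  "computable_language M \<longleftrightarrow>
     (\<exists>f. \<forall>q x y. M q x = Some y \<longleftrightarrow>
        rec_eval f [nat_of_bits q, nat_of_bits x] (nat_of_bits y))"

text \<open>The invariance property underlying Kolmogorov complexity: every program of every
  computable language \<open>M\<close> is equivalent to an \<open>L\<close>-program that is longer by at most a constant
  depending only on \<open>M\<close>. Programs of \<open>L\<close> are nonempty; the value of \<open>L\<close> at the empty
  string is never used.\<close>

definition universal_language :: "language \<Rightarrow> bool" where
  "universal_language L \<longleftrightarrow> computable_language L \<and>
     (\<forall>M. computable_language M \<longrightarrow>
        (\<exists>d::nat. \<forall>q. \<exists>q'. q' \<noteq> [] \<and> length q' \<le> length q + d \<and> (\<forall>x. L q' x = M q x)))"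


section \<open>Classifiers\<close>

type_synonym classifier = "bits \<Rightarrow> nat pmf"

definition is_classifier :: "nat \<Rightarrow> classifier \<Rightarrow> bool" where
  "is_classifier C p \<longleftrightarrow> (\<forall>x. set_pmf (p x) \<subseteq> {1..C})"

definition computes_classifier :: "language \<Rightarrow> nat \<Rightarrow> bits \<Rightarrow> classifier \<Rightarrow> bool" where
  "computes_classifier L C q p \<longleftrightarrow>
     (\<forall>x k. \<exists>rs. L q (encode_query x k) = Some (encode_rats rs) \<and> length rs = C \<and>
        (\<forall>j<C. \<bar>real_of_rat (rs ! j) - pmf (p x) (Suc j)\<bar> \<le> 1 / 2 ^ k))"

text \<open>The infimum over the empty set is \<open>\<infinity>\<close>.\<close>

definition kolmogorov_complexity :: "language \<Rightarrow> nat \<Rightarrow> classifier \<Rightarrow> enat" where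
  "kolmogorov_complexity L C p =
     (INF q \<in> {q. q \<noteq> [] \<and> computes_classifier L C q p}. enat (length q))"

text \<open>The case distinction is needed because \<^prop>\<open>ln 0 = (0::real)\<close>.\<close>

definition cross_entropy :: "classifier \<Rightarrow> bits list \<Rightarrow> nat list \<Rightarrow> ereal" where
  "cross_entropy p X Y =
     (if \<exists>i<length X. pmf (p (X ! i)) (Y ! i) = 0 then \<infinity>
      else ereal (- (1 / real (length X)) * (\<Sum>i<length X. ln (pmf (p (X ! i)) (Y ! i)))))"

definition uniform_labels :: "nat \<Rightarrow> nat \<Rightarrow> nat list pmf" where
  "uniform_labels n C = pmf_of_set {Y. length Y = n \<and> set Y \<subseteq> {1..C}}"

end

theory Submission
  imports Defs
begin

text \<open>
  For a fixed classifier the likelihoods of all label sequences sum to at most 1, so by Markov's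
  inequality a uniformly random sequence has likelihood at least \<open>2^s / C^n\<close> with probability at
  most \<open>2^(-s)\<close>. A program determines the classifier that it computes, and there are \<open>2^m\<close> programs
  of length \<open>m\<close>; hence a union bound with \<open>s = m + 2 log\<^sub>2 m + log\<^sub>2 (1/\<delta>) + 2\<close> gives total failure
  probability at most the sum over \<open>m \<ge> 1\<close> of \<open>\<delta> / (4 m^2)\<close>, which is at most \<open>\<delta>\<close>.
\<close>

section \<open>Programs and the classifiers they compute\<close>

lemma inj_rat_encode: "inj rat_encode"
proof (rule injI)
  fix r s :: rat
  assume eq: "rat_encode r = rat_encode s"
  obtain a b where r: "quotient_of r = (a, b)" by force
  obtain c d where s: "quotient_of s = (c, d)" by force
  \<comment> \<open>\<open>nat\<close> is injective only on nonnegative integers, so the positive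
    sign of the normalised denominators is what allows them to be recovered from the code.\<close>
  have "b > 0" "d > 0"
    using quotient_of_denom_pos r s by auto
  with eq have "a = c \<and> b = d"
    by (simp add: rat_encode_def r s int_encode_eq eq_nat_nat_iff)
  with r s show "r = s"
    by (metis quotient_of_div)
qed

lemma inj_encode_rats: "inj encode_rats"
proof (rule injI)
  fix rs ss
  assume "encode_rats rs = encode_rats ss"
  then have "nat_of_bits (encode_rats rs) = nat_of_bits (encode_rats ss)"
    by simp
  then have "map rat_encode rs = map rat_encode ss"
    by (simp add: encode_rats_def list_encode_eq)
  then show "rs = ss"
    using inj_rat_encode by (simp add: inj_map_eq_map)
qed

lemma eq_if_dist_le_powers_half:
  fixes a b :: real
  assumes "\<And>k. \<bar>a - b\<bar> \<le> 2 / 2 ^ k"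
  shows "a = b"
proof -
  have "(\<lambda>k. 2 / 2 ^ k :: real) \<longlonglongrightarrow> 0"
    using tendsto_mult[OF tendsto_const[of "2::real"] LIMSEQ_realpow_zero[of "1/2::real"]]
    by (simp add: power_one_over)
  then have "\<bar>a - b\<bar> \<le> 0"
    using assms by (intro LIMSEQ_le_const) auto
  then show ?thesis by simp
qed

text \<open>On every query both classifiers are approximated by the same decoded vector, so by the
  triangle inequality their values differ by at most \<open>2 / 2 ^ k\<close> for every
  \<open>k\<close>. Outside \<open>{1..C}\<close>, where the program says nothing, both vanish
  because they are classifiers over \<open>C\<close> classes.\<close>

lemma computes_classifier_unique:
  assumes p: "is_classifier C p" "computes_classifier L C q p"
    and p': "is_classifier C p'" "computes_classifier L C q p'"
  shows "p = p'"
proof (intro ext pmf_eqI)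
  fix x y
  show "pmf (p x) y = pmf (p' x) y"
  proof (cases "y \<in> {1..C}")
    case True
    then obtain j where j: "y = Suc j" "j < C"
      by (cases y) auto
    show ?thesis
    proof (rule eq_if_dist_le_powers_half)
      fix k
      obtain rs where rs: "L q (encode_query x k) = Some (encode_rats rs)"
        "\<bar>real_of_rat (rs ! j) - pmf (p x) y\<bar> \<le> 1 / 2 ^ k"
        using p(2) j unfolding computes_classifier_def by metis
      obtain ss where ss: "L q (encode_query x k) = Some (encode_rats ss)"
        "\<bar>real_of_rat (ss ! j) - pmf (p' x) y\<bar> \<le> 1 / 2 ^ k"
        using p'(2) j unfolding computes_classifier_def by metis
      have "rs = ss"
        using rs(1) ss(1) inj_encode_rats by (simp add: inj_eq)
      with rs(2) ss(2) show "\<bar>pmf (p x) y - pmf (p' x) y\<bar> \<le> 2 / 2 ^ k"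
        by (simp add: field_simps abs_le_iff)
    qed
  next
    case False
    with p(1) p'(1) have "y \<notin> set_pmf (p x)" "y \<notin> set_pmf (p' x)"
      unfolding is_classifier_def by blast+
    then show ?thesis
      by (simp add: set_pmf_iff)
  qed
qed

text \<open>A finite infimum in \<open>enat\<close> is taken over a nonempty set, and a nonempty set
  of \<open>enat\<close> contains its infimum by well-ordering.\<close>

lemma kolmogorov_complexity_attained:
  assumes "kolmogorov_complexity L C p = enat m"
  obtains q where "q \<noteq> []" "computes_classifier L C q p" "length q = m"
proof -
  let ?A = "(\<lambda>q. enat (length q)) ` {q. q \<noteq> [] \<and> computes_classifier L C q p}"
  have Inf: "Inf ?A = enat m"
    using assms by (simp add: kolmogorov_complexity_def)
  have "?A \<noteq> {}"
  proof
    assume "?A = {}"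
    with Inf have "Inf {} = enat m" by metis
    then show False
      by (simp add: top_enat_def)
  qed
  then have "Inf ?A \<in> ?A"
    unfolding Inf_enat_def by (auto intro: LeastI)
  with Inf that show thesis
    by auto
qed

section \<open>Likelihood of uniformly random labels\<close>

text \<open>The exponential form of the cross entropy. As a product it needs no separate case for
  labels of probability 0.\<close>

definition likelihood :: "classifier \<Rightarrow> bits list \<Rightarrow> nat list \<Rightarrow> real" where
  "likelihood p X Y = (\<Prod>i<length X. pmf (p (X ! i)) (Y ! i))"

lemma likelihood_nonneg: "0 \<le> likelihood p X Y"
  unfolding likelihood_def by (intro prod_nonneg) simp

lemma likelihood_Cons: "likelihood p (x # X) (y # Y) = pmf (p x) y * likelihood p X Y"
  unfolding likelihood_def length_Cons prod.lessThan_Suc_shift by simp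

text \<open>Splitting off the first label factorises the sum into the mass that \<open>p x\<close>
  gives to \<open>A\<close> and the same sum for the remaining inputs. Only an inequality holds,
  since \<open>p x\<close> may put mass outside \<open>A\<close>.\<close>

lemma sum_likelihood_le_1:
  assumes "finite A"
  shows "(\<Sum>Y | length Y = length X \<and> set Y \<subseteq> A. likelihood p X Y) \<le> 1"
proof (induction X)
  case Nil
  have "{Y. length Y = length [] \<and> set Y \<subseteq> A} = {[]}"
    by auto
  then show ?case
    by (simp add: likelihood_def)
next
  case (Cons x X)
  let ?S = "{Y. length Y = length X \<and> set Y \<subseteq> A}"
  have "{Y. length Y = length (x # X) \<and> set Y \<subseteq> A} = (\<lambda>(y, Y). y # Y) ` (A \<times> ?S)"
    by (auto simp: length_Suc_conv image_iff)
  moreover have "inj_on (\<lambda>(y, Y). y # Y) (A \<times> ?S)"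
    by (auto simp: inj_on_def)
  ultimately have "(\<Sum>Y | length Y = length (x # X) \<and> set Y \<subseteq> A. likelihood p (x # X) Y)
      = (\<Sum>(y, Y)\<in>A \<times> ?S. pmf (p x) y * likelihood p X Y)"
    by (simp add: sum.reindex likelihood_Cons case_prod_unfold)
  also have "\<dots> = (\<Sum>y\<in>A. pmf (p x) y) * (\<Sum>Y\<in>?S. likelihood p X Y)"
    by (simp add: sum_product sum.cartesian_product)
  also have "\<dots> \<le> 1 * 1"
    using Cons assms
    by (intro mult_mono sum_nonneg likelihood_nonneg)
      (auto simp flip: measure_measure_pmf_finite)
  finally show ?case by simp
qed

text \<open>Markov's inequality in counting form: each label sequence in the event contributes at
  least \<open>t / C ^ n\<close> to a sum that is at most 1, and there are \<open>C ^ n\<close>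
  equally likely sequences.\<close>

lemma prob_likelihood_ge_le:
  assumes "C \<ge> 1" "length X = n" "t > 0"
  shows "measure_pmf.prob (uniform_labels n C) {Y. likelihood p X Y \<ge> t / real C ^ n} \<le> 1 / t"
proof -
  define S where "S = {Y. length Y = n \<and> set Y \<subseteq> {1..C}}"
  let ?A = "{Y. likelihood p X Y \<ge> t / real C ^ n}"
  have S_eq: "S = {Y. set Y \<subseteq> {1..C} \<and> length Y = n}"
    by (auto simp: S_def)
  have fin: "finite S"
    unfolding S_eq by (rule finite_lists_length_eq) simp
  have card: "card S = C ^ n"
    unfolding S_eq by (simp add: card_lists_length_eq)
  with assms have ne: "S \<noteq> {}"
    by (metis card.empty not_one_le_zero power_eq_0_iff)
  have "real (card (S \<inter> ?A)) * (t / real C ^ n) \<le> (\<Sum>Y\<in>S \<inter> ?A. likelihood p X Y)"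
    by (intro sum_bounded_below) auto
  also have "\<dots> \<le> (\<Sum>Y\<in>S. likelihood p X Y)"
    using fin by (intro sum_mono2 likelihood_nonneg) auto
  also have "\<dots> \<le> 1"
    using sum_likelihood_le_1[of "{1..C}" p X] assms by (simp add: S_def)
  finally have "real (card (S \<inter> ?A)) / real C ^ n \<le> 1 / t"
    using assms by (simp add: field_simps)
  then show ?thesis
    unfolding uniform_labels_def S_def[symmetric]
    using fin ne card by (simp add: measure_pmf_of_set)
qed

text \<open>Being below a real number excludes the value \<infinity>, so all factors of the
  likelihood are positive. Then the cross entropy is \<open>- ln (likelihood p X Y) / n\<close>, and
  the claim follows by exponentiating.\<close>

lemma likelihood_gt_if_cross_entropy_less:
  assumes "n \<ge> 1" "C \<ge> 1" "length X = n"
    and less: "cross_entropy p X Y < ereal (ln (real C) - ln 2 / real n * s)"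
  shows "likelihood p X Y > 2 powr s / real C ^ n"
proof -
  have pos: "pmf (p (X ! i)) (Y ! i) > 0" if "i < n" for i
    using less assms that by (auto simp: cross_entropy_def pmf_pos split: if_splits)
  then have nz: "\<not> (\<exists>i<length X. pmf (p (X ! i)) (Y ! i) = 0)"
    using assms by force
  have lnL: "ln (likelihood p X Y) = (\<Sum>i<n. ln (pmf (p (X ! i)) (Y ! i)))"
    unfolding likelihood_def using pos assms by (subst ln_prod) force+
  have "- (1 / real n) * ln (likelihood p X Y) < ln (real C) - ln 2 / real n * s"
    using less nz assms unfolding cross_entropy_def lnL by (simp only: if_False less_ereal.simps)
  then have "s * ln 2 - real n * ln (real C) < ln (likelihood p X Y)"
    using assms by (simp add: field_simps)
  moreover have "ln (2 powr s / real C ^ n) = s * ln 2 - real n * ln (real C)"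
    using assms by (simp add: ln_div ln_powr ln_realpow)
  moreover have "likelihood p X Y > 0"
    unfolding likelihood_def using pos assms by (intro prod_pos) auto
  ultimately show ?thesis
    using assms by (subst ln_less_cancel_iff[symmetric]) auto
qed

text \<open>The quantifier over \<open>p\<close> costs nothing in probability: \<open>q\<close>
  computes either no classifier, and the event is empty, or exactly one, to which the Markov bound
  with \<open>t = 2 powr s\<close> applies.\<close>

lemma prob_program_cross_entropy_less:
  assumes "n \<ge> 1" "C \<ge> 1" "length X = n"
  shows "measure_pmf.prob (uniform_labels n C)
    {Y. \<exists>p. is_classifier C p \<and> computes_classifier L C q p \<and>
       cross_entropy p X Y < ereal (ln (real C) - ln 2 / real n * s)} \<le> 2 powr (- s)"
    (is "measure_pmf.prob _ ?A \<le> _")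
proof (cases "\<exists>p. is_classifier C p \<and> computes_classifier L C q p")
  case False
  then have "?A = {}" by auto
  then show ?thesis by (simp only: measure_empty powr_ge_zero)
next
  case True
  then obtain p where p: "is_classifier C p" "computes_classifier L C q p" by auto
  have "?A \<subseteq> {Y. likelihood p X Y \<ge> 2 powr s / real C ^ n}"
    using computes_classifier_unique[OF p] likelihood_gt_if_cross_entropy_less[OF assms]
    by (force intro: less_imp_le)
  then have "measure_pmf.prob (uniform_labels n C) ?A
      \<le> measure_pmf.prob (uniform_labels n C) {Y. likelihood p X Y \<ge> 2 powr s / real C ^ n}"
    by (intro measure_pmf.finite_measure_mono) auto
  also have "\<dots> \<le> 1 / 2 powr s"
    using assms by (intro prob_likelihood_ge_le) auto
  finally show ?thesis
    by (simp add: powr_minus_divide)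
qed

section \<open>Union bound over all programs\<close>

text \<open>The factor \<open>2 ^ length q\<close> cancels the number of programs of that length.
  The quadratic factor makes the remaining series over lengths converge.\<close>

lemma measure_UN_programs_le:
  fixes A :: "bits \<Rightarrow> 'a set" and \<delta> :: real
  assumes A: "\<And>q. q \<noteq> [] \<Longrightarrow>
      measure_pmf.prob M (A q) \<le> \<delta> / (4 * 2 ^ length q * real (length q) ^ 2)"
    and "\<delta> \<ge> 0"
  shows "measure_pmf.prob M (\<Union>q\<in>{q. q \<noteq> []}. A q) \<le> \<delta>"
proof -
  \<comment> \<open>The shift by one makes the lengths start at 1, since the empty program is
    excluded.\<close>
  define B where "B m = (\<Union>q\<in>{q::bits. length q = Suc m}. A q)" for m
  have fin: "finite {q::bits. length q = m}" and card: "card {q::bits. length q = m} = 2 ^ m" for m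
    using finite_lists_length_eq[of "UNIV :: bool set" m] card_lists_length_eq[of "UNIV :: bool set" m]
    by auto
  have B: "measure_pmf.prob M (B m) \<le> \<delta> / 4 * (1 / (real m + 1) ^ 2)" for m
  proof -
    have "measure_pmf.prob M (B m) \<le> (\<Sum>q\<in>{q. length q = Suc m}. measure_pmf.prob M (A q))"
      unfolding B_def by (intro measure_pmf.finite_measure_subadditive_finite fin) auto
    also have "\<dots> \<le> (\<Sum>q\<in>{q::bits. length q = Suc m}.
        \<delta> / (4 * 2 ^ Suc m * real (Suc m) ^ 2))"
    proof (rule sum_mono)
      fix q :: bits
      assume "q \<in> {q. length q = Suc m}"
      then have "q \<noteq> []" "length q = Suc m" by auto
      with A[of q] show "measure_pmf.prob M (A q) \<le> \<delta> / (4 * 2 ^ Suc m * real (Suc m) ^ 2)"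
        by metis
    qed
    also have "\<dots> = 2 ^ Suc m * (\<delta> / (4 * 2 ^ Suc m * real (Suc m) ^ 2))"
      by (simp add: card)
    also have "\<dots> = \<delta> / 4 * (1 / (real m + 1) ^ 2)"
      by (simp add: add.commute)
    finally show ?thesis .
  qed
  \<comment> \<open>The Basel series, scaled by \<open>\<delta> / 4\<close>.\<close>
  have sums: "(\<lambda>m. \<delta> / 4 * (1 / (real m + 1) ^ 2)) sums (\<delta> / 4 * (pi\<^sup>2 / 6))"
    using inverse_squares_sums by (intro sums_mult) (simp add: add.commute)
  have summable: "summable (\<lambda>m. measure_pmf.prob M (B m))"
    using B by (intro summable_comparison_test'[OF sums_summable[OF sums]]) auto
  have "{q :: bits. q \<noteq> []} = (\<Union>m. {q. length q = Suc m})"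
    by (auto simp flip: length_greater_0_conv simp: gr0_conv_Suc)
  then have UN: "(\<Union>q\<in>{q. q \<noteq> []}. A q) = (\<Union>m. B m)"
    by (simp only: B_def UN_UN_flatten)
  have "measure_pmf.prob M (\<Union>q\<in>{q. q \<noteq> []}. A q) \<le> (\<Sum>m. measure_pmf.prob M (B m))"
    unfolding UN
    by (rule measure_pmf.finite_measure_subadditive_countably[OF _ summable]) simp
  also have "\<dots> \<le> \<delta> / 4 * (pi\<^sup>2 / 6)"
    using suminf_le[OF B summable sums_summable[OF sums]] sums_unique[OF sums] by simp
  \<comment> \<open>The crude bound \<open>pi < 4\<close> suffices, as 16/24 is below 1.\<close>
  also have "\<dots> \<le> \<delta> * 1"
  proof -
    have "pi\<^sup>2 \<le> 4\<^sup>2"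
      using pi_less_4 by (intro power_mono) auto
    then have "\<delta> * (pi\<^sup>2 / 24) \<le> \<delta> * 1"
      using \<open>\<delta> \<ge> 0\<close> by (intro mult_left_mono) auto
    then show ?thesis by simp
  qed
  finally show ?thesis by simp
qed

lemma prob_cross_entropy_ge_program_bound:
  assumes "n \<ge> 1" "C \<ge> 1" "length X = n" "0 < \<delta>"
  shows "measure_pmf.prob (uniform_labels n C)
    {Y. \<forall>p. is_classifier C p \<longrightarrow>
       cross_entropy p X Y \<ge>
         (case kolmogorov_complexity L C p of
            enat m \<Rightarrow> ereal (ln (real C) - ln 2 / real n *
              (real m + 2 * log 2 (real m) + log 2 (1 / \<delta>) + 2))
          | \<infinity> \<Rightarrow> - \<infinity>)}
    \<ge> 1 - \<delta>"
    (is "measure_pmf.prob ?M ?G \<ge> _")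
proof -
  define s where "s m = real m + 2 * log 2 (real m) + log 2 (1 / \<delta>) + 2" for m
  define A where "A q = {Y. \<exists>p. is_classifier C p \<and> computes_classifier L C q p \<and>
    cross_entropy p X Y < ereal (ln (real C) - ln 2 / real n * s (length q))}" for q
  have "measure_pmf.prob ?M (A q) \<le> \<delta> / (4 * 2 ^ length q * real (length q) ^ 2)"
    if "q \<noteq> []" for q
  proof -
    define m where "m = length q"
    have m: "real m > 0"
      using that by (simp add: m_def)
    \<comment> \<open>Each summand of \<open>s m\<close> supplies one factor of the weight needed
      for the union bound: \<open>m\<close> pays for the number of programs, twice the logarithm
      gives the square, and the constant 2 gives the 4.\<close>
    have "2 powr s m = 2 powr real m * (2 powr log 2 (real m) * 2 powr log 2 (real m))
        * 2 powr log 2 (1 / \<delta>) * 2 powr 2"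
      unfolding s_def mult_2 powr_add ..
    also have "\<dots> = 4 * 2 ^ m * real m ^ 2 / \<delta>"
      using m assms by (simp add: powr_realpow power2_eq_square)
    finally have "2 powr (- s m) = \<delta> / (4 * 2 ^ m * real m ^ 2)"
      by (simp add: powr_minus_divide)
    then show ?thesis
      unfolding A_def m_def[symmetric]
      using prob_program_cross_entropy_less[OF assms(1-3), of L q "s m"] by simp
  qed
  then have "measure_pmf.prob ?M (\<Union>q\<in>{q. q \<noteq> []}. A q) \<le> \<delta>"
    using assms by (intro measure_UN_programs_le) auto
  moreover have "- ?G \<subseteq> (\<Union>q\<in>{q. q \<noteq> []}. A q)"
  proof
    fix Y
    assume "Y \<in> - ?G"
    then obtain p where p: "is_classifier C p"
      "cross_entropy p X Y < (case kolmogorov_complexity L C p of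
         enat m \<Rightarrow> ereal (ln (real C) - ln 2 / real n * s m) | \<infinity> \<Rightarrow> - \<infinity>)"
      unfolding s_def by (auto simp: not_le)
    \<comment> \<open>For infinite complexity the bound is \<open>- \<infinity>\<close>, which
      cannot be violated. So a violating classifier has a shortest program \<open>q\<close>, and
      that \<open>q\<close> is the index of the bad event.\<close>
    then obtain m where m: "kolmogorov_complexity L C p = enat m"
      by (cases "kolmogorov_complexity L C p") auto
    then obtain q where "q \<noteq> []" "computes_classifier L C q p" "length q = m"
      by (rule kolmogorov_complexity_attained)
    with p m show "Y \<in> (\<Union>q\<in>{q. q \<noteq> []}. A q)"
      by (auto simp: A_def)
  qed
  then have "measure_pmf.prob ?M (- ?G) \<le> measure_pmf.prob ?M (\<Union>q\<in>{q. q \<noteq> []}. A q)"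
    by (intro measure_pmf.finite_measure_mono) auto
  ultimately show ?thesis
    using measure_pmf.prob_compl[of ?G ?M] by (simp add: Compl_eq_Diff_UNIV)
qed

section \<open>Sample size for bounded complexity\<close>

lemma complexity_penalty_le:
  fixes B c \<delta> \<epsilon> :: real
  assumes "B \<ge> 1" "\<epsilon> > 0"
  obtains N :: nat where "N \<ge> 1" "\<And>n m. n \<ge> N \<Longrightarrow> real m \<le> B \<Longrightarrow>
    ln 2 / real n * (real m + 2 * log 2 (real m) + log 2 (1 / \<delta>) + c) \<le> \<epsilon>"
proof -
  define s where "s = B + 2 * log 2 B + log 2 (1 / \<delta>) + c"
  \<comment> \<open>This solves \<open>ln 2 * s / n \<le> \<epsilon>\<close> for \<open>n\<close>.
    Since \<open>s\<close> may be negative, \<open>N\<close> may be 0; the witness used below is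
    \<open>max 1 N\<close>, so that \<open>n\<close> is positive.\<close>
  obtain N :: nat where N: "real N \<ge> ln 2 * s / \<epsilon>"
    using real_arch_simple by blast
  show thesis
  proof (rule that)
    fix n m :: nat
    assume n: "n \<ge> max 1 N" and m: "real m \<le> B"
    \<comment> \<open>For \<open>m = 0\<close> the left side is 0 by the convention
      \<open>ln 0 = 0\<close>, and the right side is nonnegative because
      \<open>B \<ge> 1\<close>.\<close>
    have "log 2 (real m) \<le> log 2 B"
      using m assms by (cases "m = 0") (auto simp: log_def intro!: divide_right_mono)
    with m have "ln 2 / real n * (real m + 2 * log 2 (real m) + log 2 (1 / \<delta>) + c)
        \<le> ln 2 / real n * s"
      unfolding s_def by (intro mult_left_mono) auto
    also have "ln 2 * s / \<epsilon> \<le> real n"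
      using N n by linarith
    then have "ln 2 / real n * s \<le> \<epsilon>"
      using n assms by (simp add: field_simps)
    finally show "ln 2 / real n * (real m + 2 * log 2 (real m) + log 2 (1 / \<delta>) + c) \<le> \<epsilon>" .
  qed simp
qed

text \<open>Once \<open>n\<close> is large, the penalty is at most \<epsilon> for all complexities
  up to \<open>B\<close> at once, so the good event of the first bound is contained in the present
  one. \<open>N\<close> is chosen before \<open>X\<close>, which gives uniformity in the
  inputs.\<close>

lemma prob_cross_entropy_ge_bounded_complexity:
  fixes B \<epsilon> \<delta> :: real
  assumes "C \<ge> 1" "B \<ge> 1" "\<epsilon> > 0" "0 < \<delta>"
  shows "\<exists>N::nat. \<forall>n\<ge>N. \<forall>X::bits list. length X = n \<longrightarrow>
    measure_pmf.prob (uniform_labels n C)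
      {Y. \<forall>p. is_classifier C p \<longrightarrow>
         ereal_of_enat (kolmogorov_complexity L C p) \<le> ereal B \<longrightarrow>
         cross_entropy p X Y \<ge> ereal (ln (real C) - \<epsilon>)}
      \<ge> 1 - \<delta>"
proof -
  obtain N :: nat where N: "N \<ge> 1" "\<And>n m. n \<ge> N \<Longrightarrow> real m \<le> B \<Longrightarrow>
      ln 2 / real n * (real m + 2 * log 2 (real m) + log 2 (1 / \<delta>) + 2) \<le> \<epsilon>"
    using complexity_penalty_le assms by blast
  show ?thesis
  proof (intro exI[of _ N] allI impI)
    fix n and X :: "bits list"
    assume n: "n \<ge> N" and X: "length X = n"
    let ?G = "{Y. \<forall>p. is_classifier C p \<longrightarrow>
       cross_entropy p X Y \<ge>
         (case kolmogorov_complexity L C p of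
            enat m \<Rightarrow> ereal (ln (real C) - ln 2 / real n *
              (real m + 2 * log 2 (real m) + log 2 (1 / \<delta>) + 2))
          | \<infinity> \<Rightarrow> - \<infinity>)}"
    let ?H = "{Y. \<forall>p. is_classifier C p \<longrightarrow>
       ereal_of_enat (kolmogorov_complexity L C p) \<le> ereal B \<longrightarrow>
       cross_entropy p X Y \<ge> ereal (ln (real C) - \<epsilon>)}"
    have "?G \<subseteq> ?H"
    proof (intro subsetI CollectI allI impI)
      fix Y p
      assume Y: "Y \<in> ?G" and p: "is_classifier C p"
        and K: "ereal_of_enat (kolmogorov_complexity L C p) \<le> ereal B"
      obtain m where m: "kolmogorov_complexity L C p = enat m" "real m \<le> B"
        using K by (cases "kolmogorov_complexity L C p") auto
      have "ereal (ln (real C) - \<epsilon>) \<le> ereal (ln (real C) - ln 2 / real n *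
          (real m + 2 * log 2 (real m) + log 2 (1 / \<delta>) + 2))"
        using N(2)[OF n m(2)] by simp
      also have "\<dots> \<le> cross_entropy p X Y"
        using Y p m(1) by fastforce
      finally show "ereal (ln (real C) - \<epsilon>) \<le> cross_entropy p X Y" .
    qed
    then have "measure_pmf.prob (uniform_labels n C) ?G \<le> measure_pmf.prob (uniform_labels n C) ?H"
      by (intro measure_pmf.finite_measure_mono) auto
    moreover have "1 - \<delta> \<le> measure_pmf.prob (uniform_labels n C) ?G"
      using N n X assms by (intro prob_cross_entropy_ge_program_bound) auto
    ultimately show "1 - \<delta> \<le> measure_pmf.prob (uniform_labels n C) ?H"
      by linarith
  qed
qed

theorem theorem3p1:
  fixes L :: language
  assumes "universal_language L"
  shows "(\<exists>c::real. \<forall>(n::nat) (C::nat) (X::bits list) (\<delta>::real).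
            n \<ge> 1 \<longrightarrow> C \<ge> 2 \<longrightarrow> length X = n \<longrightarrow> 0 < \<delta> \<longrightarrow> \<delta> < 1 \<longrightarrow>
            measure_pmf.prob (uniform_labels n C)
              {Y. \<forall>p. is_classifier C p \<longrightarrow>
                 cross_entropy p X Y \<ge>
                   (case kolmogorov_complexity L C p of
                      enat m \<Rightarrow> ereal (ln (real C) - ln 2 / real n *
                        (real m + 2 * log 2 (real m) + log 2 (1 / \<delta>) + c))
                    | \<infinity> \<Rightarrow> - \<infinity>)}
              \<ge> 1 - \<delta>) \<and>
         (\<forall>(C::nat) (B::real) (\<epsilon>::real) (\<delta>::real).
            C \<ge> 2 \<longrightarrow> B \<ge> 1 \<longrightarrow> \<epsilon> > 0 \<longrightarrow> 0 < \<delta> \<longrightarrow> \<delta> < 1 \<longrightarrow>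
            (\<exists>N::nat. \<forall>n\<ge>N. \<forall>X::bits list. length X = n \<longrightarrow>
               measure_pmf.prob (uniform_labels n C)
                 {Y. \<forall>p. is_classifier C p \<longrightarrow>
                    ereal_of_enat (kolmogorov_complexity L C p) \<le> ereal B \<longrightarrow>
                    cross_entropy p X Y \<ge> ereal (ln (real C) - \<epsilon>)}
                 \<ge> 1 - \<delta>))"
proof (rule conjI, goal_cases)
  case 1
  show ?case
    \<comment> \<open>The witness for \<open>c\<close> is the 2 that absorbs the factor 4 in the
      union bound.\<close>
    by (intro exI[of _ 2] allI impI prob_cross_entropy_ge_program_bound) auto
next
  case 2
  show ?case
    by (intro allI impI prob_cross_entropy_ge_bounded_complexity) auto
qed

end
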